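(* For a semilattice $X$ the semigroup $\beta(X)$ is a band if and only if each antichain in $X$ is finite.
   Context: A semilattice is a commutative semigroup with $xx=x$ for all $x$. A band is a semigroup with $xx=x$ for all $x$. A subset $A$ of a semigroup $X$ is an antichain if $ab\notin\{a,b\}$ for any distinct points $a,b\in A$. $\beta(X)$ is the set of all ultrafilters on the set $X$ (principal ones included), endowed with the operation $\mathcal U*\mathcal V=\big\langle\bigcup_{x\in U}xV_x: U\in\mathcal U,\ (V_x)_{x\in U}\in\mathcal V^U\big\rangle$, where $\langle\mathcal B\rangle=\{A\subset X:\exists B\in\mathcal B,\ B\subset A\}$ for a family $\mathcal B$ of subsets of $X$. With this operation $\beta(X)$ is a semigroup. *)

theory Defs
  imports Main
begin

locale band = semigroup +
  assumes idem: "f a a = a"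

definition antichain :: "('a \<Rightarrow> 'a \<Rightarrow> 'a) \<Rightarrow> 'a set \<Rightarrow> bool" where
  "antichain f A \<longleftrightarrow> (\<forall>a\<in>A. \<forall>b\<in>A. a \<noteq> b \<longrightarrow> f a b \<notin> {a, b})"

text \<open>
  The library order on filters is reversed inclusion: \<open>G \<le> F\<close> means that \<open>G\<close> contains every
  member of \<open>F\<close>. So \<open>is_ultrafilter F\<close> says that \<open>F\<close> is maximal among the proper filters.
\<close>

definition is_ultrafilter :: "'a filter \<Rightarrow> bool" where
  "is_ultrafilter F \<longleftrightarrow> F \<noteq> bot \<and> (\<forall>G. G \<noteq> bot \<longrightarrow> G \<le> F \<longrightarrow> G = F)"

definition members :: "'a filter \<Rightarrow> 'a set set" where
  "members F = {A. eventually (\<lambda>x. x \<in> A) F}"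

definition upward_closure :: "'a set set \<Rightarrow> 'a set set" where
  "upward_closure \<B> = {A. \<exists>B\<in>\<B>. B \<subseteq> A}"

definition product_family :: "('a \<Rightarrow> 'a \<Rightarrow> 'a) \<Rightarrow> 'a filter \<Rightarrow> 'a filter \<Rightarrow> 'a set set" where
  "product_family f F G =
     upward_closure {\<Union>x\<in>U. f x ` V x | U V. U \<in> members F \<and> (\<forall>x\<in>U. V x \<in> members G)}"

text \<open>
  \<open>Abs_filter\<close> is only meaningful for families that are filters; \<open>members_filter_product\<close>
  below shows that this is the case here.
\<close>

definition filter_product :: "('a \<Rightarrow> 'a \<Rightarrow> 'a) \<Rightarrow> 'a filter \<Rightarrow> 'a filter \<Rightarrow> 'a filter" where
  "filter_product f F G = Abs_filter (\<lambda>P. Collect P \<in> product_family f F G)"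

lemma product_family_iff:
  "A \<in> product_family f F G \<longleftrightarrow> eventually (\<lambda>x. eventually (\<lambda>y. f x y \<in> A) G) F"
proof
  assume "A \<in> product_family f F G"
  then obtain U V where U: "eventually (\<lambda>x. x \<in> U) F"
    and V: "\<forall>x\<in>U. eventually (\<lambda>y. y \<in> V x) G" and sub: "(\<Union>x\<in>U. f x ` V x) \<subseteq> A"
    unfolding product_family_def upward_closure_def members_def by blast
  have "eventually (\<lambda>y. f x y \<in> A) G" if "x \<in> U" for x
    using V[rule_format, OF that] by (rule eventually_mono) (use sub that in blast)
  then show "eventually (\<lambda>x. eventually (\<lambda>y. f x y \<in> A) G) F"
    using U by (rule eventually_mono[rotated])
next
  assume *: "eventually (\<lambda>x. eventually (\<lambda>y. f x y \<in> A) G) F"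
  define U where "U = {x. eventually (\<lambda>y. f x y \<in> A) G}"
  define V where "V = (\<lambda>x. {y. f x y \<in> A})"
  have "U \<in> members F" "\<forall>x\<in>U. V x \<in> members G" "(\<Union>x\<in>U. f x ` V x) \<subseteq> A"
    using * by (auto simp: U_def V_def members_def)
  then show "A \<in> product_family f F G"
    unfolding product_family_def upward_closure_def by blast
qed

lemma eventually_filter_product:
  "eventually P (filter_product f F G) \<longleftrightarrow> eventually (\<lambda>x. eventually (\<lambda>y. P (f x y)) G) F"
proof -
  have "is_filter (\<lambda>P. Collect P \<in> product_family f F G)"
  proof
    fix P Q :: "'a \<Rightarrow> bool"
    show "Collect (\<lambda>x. P x \<and> Q x) \<in> product_family f F G"
      if "Collect P \<in> product_family f F G" "Collect Q \<in> product_family f F G"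
      using that by (simp add: product_family_iff eventually_conj_iff)
    show "Collect Q \<in> product_family f F G"
      if "\<forall>x. P x \<longrightarrow> Q x" "Collect P \<in> product_family f F G"
      using that by (auto simp: product_family_iff elim!: eventually_mono)
  qed (simp add: product_family_iff)
  then show ?thesis
    by (simp add: filter_product_def eventually_Abs_filter product_family_iff)
qed

lemma members_filter_product: "members (filter_product f F G) = product_family f F G"
  by (auto simp: members_def eventually_filter_product product_family_iff)

lemma is_ultrafilter_iff:
  "is_ultrafilter F \<longleftrightarrow> F \<noteq> bot \<and> (\<forall>P. eventually P F \<or> eventually (\<lambda>x. \<not> P x) F)"
proof (intro iffI conjI allI)
  assume F: "is_ultrafilter F"
  then show "F \<noteq> bot" by (simp add: is_ultrafilter_def)
  fix P
  show "eventually P F \<or> eventually (\<lambda>x. \<not> P x) F"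
  proof (cases "inf F (principal {x. P x}) = bot")
    case True
    then show ?thesis
      by (simp add: trivial_limit_def eventually_inf_principal)
  next
    case False
    then have "inf F (principal {x. P x}) = F"
      using F by (simp add: is_ultrafilter_def)
    moreover have "eventually P (inf F (principal {x. P x}))"
      by (simp add: eventually_inf_principal)
    ultimately show ?thesis by simp
  qed
next
  assume F: "F \<noteq> bot \<and> (\<forall>P. eventually P F \<or> eventually (\<lambda>x. \<not> P x) F)"
  show "is_ultrafilter F"
    unfolding is_ultrafilter_def
  proof (intro conjI allI impI)
    fix G assume G: "G \<noteq> bot" "G \<le> F"
    have "eventually P F" if "eventually P G" for P
    proof (rule ccontr)
      assume "\<not> eventually P F"
      then have "eventually (\<lambda>x. \<not> P x) G"
        using F G(2) by (auto simp: le_filter_def)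
      with that have "eventually (\<lambda>x. False) G"
        by (rule eventually_elim2) simp
      with G(1) show False by (simp add: trivial_limit_def)
    qed
    with G(2) show "G = F" by (auto simp: le_filter_def filter_eq_iff)
  qed (use F in simp)
qed

lemma is_ultrafilter_principal: "is_ultrafilter (principal {x})"
  by (auto simp: is_ultrafilter_iff eventually_principal principal_eq_bot_iff)

lemma is_ultrafilter_filter_product:
  assumes "is_ultrafilter F" "is_ultrafilter G"
  shows "is_ultrafilter (filter_product f F G)"
proof -
  have neg: "eventually (\<lambda>x. \<not> P x) H \<longleftrightarrow> \<not> eventually P H"
    if "is_ultrafilter H" for H :: "'a filter" and P
  proof -
    have "\<not> (eventually P H \<and> eventually (\<lambda>x. \<not> P x) H)"
      using that by (auto simp: is_ultrafilter_iff trivial_limit_def simp flip: eventually_conj_iff)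
    then show ?thesis using that by (auto simp: is_ultrafilter_iff)
  qed
  show ?thesis
    using assms
    by (auto simp: is_ultrafilter_iff[of "filter_product f F G"] trivial_limit_def
        eventually_filter_product neg) (simp_all add: is_ultrafilter_iff trivial_limit_def)
qed

typedef 'a beta = "{F :: 'a filter. is_ultrafilter F}"
  by (rule exI[of _ "principal {undefined}"]) (simp add: is_ultrafilter_principal)

setup_lifting type_definition_beta

lift_definition beta_mult :: "('a \<Rightarrow> 'a \<Rightarrow> 'a) \<Rightarrow> 'a beta \<Rightarrow> 'a beta \<Rightarrow> 'a beta"
  is filter_product
  by (rule is_ultrafilter_filter_product)

end

theory Submission
  imports Defs
begin

text \<open>
  An ultrafilter \<open>F\<close> is idempotent as soon as every member \<open>A\<close> of \<open>F\<close> belongs to \<open>F * F\<close>, that is,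
  for \<open>F\<close>-many \<open>x\<close> the product \<open>x y\<close> lies in \<open>A\<close> for \<open>F\<close>-many \<open>y\<close>. The link with
  antichains is that \<open>x\<close> and \<open>y\<close> are incomparable whenever they lie in \<open>A\<close> but \<open>x y\<close> does not.

  If idempotence of \<open>F\<close> fails at \<open>A\<close>, then \<open>F\<close>-many \<open>x \<in> A\<close> satisfy \<open>x y \<notin> A\<close> for \<open>F\<close>-many \<open>y\<close>. Any
  finitely many such \<open>x\<close> can therefore be prolonged by a further one whose products with all of
  them avoid \<open>A\<close>, which produces an infinite antichain (\<open>infinite_antichain_if_not_idempotent\<close>).

  Conversely, an infinite antichain \<open>A\<close> contains no product of two of its distinct points, since such
  a product lies below both factors. Hence no ultrafilter that contains \<open>A\<close> and no finite
  set is idempotent (\<open>not_idempotent_on_antichain\<close>); one exists by Zorn's lemma.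
\<close>

lemma ultrafilter_below_exists:
  assumes "F \<noteq> bot"
  obtains G where "is_ultrafilter G" "G \<le> F"
proof -
  define \<A> where "\<A> = {G. G \<noteq> bot \<and> G \<le> F}"
  have "\<exists>G\<in>\<A>. \<forall>H\<in>\<A>. G \<ge> H \<longrightarrow> H = G"
  proof (rule predicate_Zorn)
    show "partial_order_on \<A> (relation_of (\<ge>) \<A>)"
      by (rule partial_order_on_relation_ofI) auto
  next
    fix C assume C: "C \<in> Chains (relation_of (\<ge>) \<A>)"
    have CA: "C \<subseteq> \<A>" and total: "\<And>G H. G \<in> C \<Longrightarrow> H \<in> C \<Longrightarrow> G \<le> H \<or> H \<le> G"
      using C unfolding Chains_def relation_of_def by auto
    show "\<exists>L\<in>\<A>. \<forall>G\<in>C. G \<ge> L"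
    proof (cases "C = {}")
      case True
      then show ?thesis using assms by (auto simp: \<A>_def)
    next
      case False
      \<comment> \<open>A chain is a filter base, so a failure of its infimum to be proper would already occur
        in one of its elements.\<close>
      have "eventually P (Inf C) \<longleftrightarrow> (\<exists>G\<in>C. eventually P G)" for P
        by (rule eventually_Inf_base[OF False]) (metis total inf.absorb1 inf.absorb2 order_refl)
      then have "Inf C \<noteq> bot"
        using CA by (auto simp: trivial_limit_def \<A>_def)
      moreover have "Inf C \<le> F"
        using False CA by (auto simp: \<A>_def intro: Inf_lower2)
      ultimately show ?thesis
        by (intro bexI[of _ "Inf C"]) (auto simp: \<A>_def Inf_lower)
    qed
  qed
  then obtain G where "G \<in> \<A>" and max: "\<And>H. H \<in> \<A> \<Longrightarrow> H \<le> G \<Longrightarrow> H = G"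
    by blast
  then have "is_ultrafilter G" "G \<le> F"
    unfolding is_ultrafilter_def \<A>_def by auto
  then show thesis by (rule that)
qed

lemma filter_product_assoc:
  assumes "semigroup f"
  shows "filter_product f (filter_product f F G) H = filter_product f F (filter_product f G H)"
  by (simp add: filter_eq_iff eventually_filter_product semigroup.assoc[OF assms])

lemma band_beta_mult_iff:
  assumes "semigroup f"
  shows "band (beta_mult f) \<longleftrightarrow> (\<forall>F. is_ultrafilter F \<longrightarrow> filter_product f F F = F)"
proof -
  have "semigroup (beta_mult f)"
  proof
    fix u v w :: "'a beta"
    show "beta_mult f (beta_mult f u v) w = beta_mult f u (beta_mult f v w)"
      by (transfer fixing: f) (simp add: filter_product_assoc[OF assms])
  qed
  then have "band (beta_mult f) \<longleftrightarrow> (\<forall>u. beta_mult f u u = u)"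
    by (simp add: band_def band_axioms_def)
  also have "\<dots> \<longleftrightarrow> (\<forall>F. is_ultrafilter F \<longrightarrow> filter_product f F F = F)"
    by transfer auto
  finally show ?thesis .
qed

text \<open>
  The antichain is a maximal subset \<open>M\<close> of \<open>B\<close> with products of distinct points outside \<open>A\<close>, where
  \<open>A\<close> witnesses the failure of idempotence and \<open>B\<close> consists of the \<open>x \<in> A\<close> with \<open>x y \<notin> A\<close> for
  \<open>F\<close>-many \<open>y\<close>. Were \<open>M\<close> finite, the intersection of finitely many members of \<open>F\<close> would provide a
  point extending it.
\<close>

lemma infinite_antichain_if_not_idempotent:
  assumes "semilattice f" and F: "is_ultrafilter F" and neq: "filter_product f F F \<noteq> F"
  obtains M where "antichain f M" "infinite M"
proof -
  interpret semilattice f by fact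
  have not_ev: "eventually (\<lambda>x. \<not> P x) F" if "\<not> eventually P F" for P
    using F that by (auto simp: is_ultrafilter_iff)
  have "\<not> filter_product f F F \<le> F"
    using neq F is_ultrafilter_filter_product[OF F F] by (auto simp: is_ultrafilter_def)
  then obtain P where P: "eventually P F" and nP: "\<not> eventually P (filter_product f F F)"
    by (auto simp: le_filter_def)
  define A where "A = Collect P"
  define B where "B = {x \<in> A. eventually (\<lambda>y. f x y \<notin> A) F}"
  have "eventually (\<lambda>x. \<not> eventually (\<lambda>y. f x y \<in> A) F) F"
    using not_ev[OF nP[unfolded eventually_filter_product]] by (simp add: A_def)
  then have B: "eventually (\<lambda>x. x \<in> B) F"
    using P by eventually_elim (auto simp: A_def B_def dest: not_ev)
  define \<M> where "\<M> = {M. M \<subseteq> B \<and> pairwise (\<lambda>x y. f x y \<notin> A) M}"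
  have "\<exists>M\<in>\<M>. \<forall>N\<in>\<M>. M \<subseteq> N \<longrightarrow> N = M"
  proof (rule subset_Zorn')
    fix \<C> assume C: "subset.chain \<M> \<C>"
    then have "pairwise (\<lambda>x y. f x y \<notin> A) (\<Union>\<C>)"
      by (intro pairwise_chain_Union) (auto simp: \<M>_def subset_chain_def chain_subset_def)
    then show "\<Union>\<C> \<in> \<M>"
      using C by (auto simp: \<M>_def subset_chain_def)
  qed
  then obtain M where M: "M \<in> \<M>" and max: "\<And>N. N \<in> \<M> \<Longrightarrow> M \<subseteq> N \<Longrightarrow> N = M"
    by blast
  have MB: "M \<subseteq> B" and pw: "pairwise (\<lambda>x y. f x y \<notin> A) M"
    using M by (auto simp: \<M>_def)
  have "infinite M"
  proof
    assume "finite M"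
    moreover have "eventually (\<lambda>y. f x y \<notin> A) F" if "x \<in> M" for x
      using that MB by (auto simp: B_def)
    ultimately have "eventually (\<lambda>y. \<forall>x\<in>M. f x y \<notin> A) F"
      by (intro eventually_ball_finite) auto
    with B have "eventually (\<lambda>y. y \<in> B \<and> (\<forall>x\<in>M. f x y \<notin> A)) F"
      by (rule eventually_conj)
    moreover have "F \<noteq> bot"
      using F by (simp add: is_ultrafilter_def)
    ultimately obtain y where y: "y \<in> B" "\<forall>x\<in>M. f x y \<notin> A"
      using eventually_happens' by blast
    \<comment> \<open>Idempotence of \<open>y\<close> makes this point new.\<close>
    then have "y \<notin> M"
      by (auto simp: B_def)
    moreover have "insert y M \<in> \<M>"
      using y MB pw commute[of y] by (auto simp: \<M>_def pairwise_insert)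
    ultimately show False
      using max by blast
  qed
  moreover have "antichain f M"
    unfolding antichain_def
  proof (intro ballI impI)
    fix x y assume "x \<in> M" "y \<in> M" "x \<noteq> y"
    then have "x \<in> A" "y \<in> A" "f x y \<notin> A"
      using pw MB by (auto simp: B_def dest: pairwiseD)
    then show "f x y \<notin> {x, y}"
      by auto
  qed
  ultimately show thesis
    using that by blast
qed

text \<open>
  If \<open>x y\<close> were in \<open>A\<close>, then \<open>x\<close> and \<open>x y\<close> would be distinct points of \<open>A\<close> with product \<open>x y\<close>.
\<close>

lemma antichain_product_notin:
  assumes "semilattice f" "antichain f A" "x \<in> A" "y \<in> A" "x \<noteq> y"
  shows "f x y \<notin> A"
proof
  interpret semilattice f by fact
  assume "f x y \<in> A"
  moreover have "x \<noteq> f x y"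
    using assms unfolding antichain_def by fastforce
  ultimately have "f x (f x y) \<notin> {x, f x y}"
    using assms unfolding antichain_def by blast
  then show False by simp
qed

text \<open>
  An idempotent \<open>F\<close> would provide an \<open>x \<in> A\<close> with \<open>x y \<in> A\<close> for \<open>F\<close>-many \<open>y \<in> A\<close>; the only such \<open>y\<close> is
  \<open>x\<close> itself, which a filter finer than the cofinite one ignores.
\<close>

lemma not_idempotent_on_antichain:
  assumes "semilattice f" "antichain f A" and F: "F \<noteq> bot" "F \<le> inf cofinite (principal A)"
  shows "filter_product f F F \<noteq> F"
proof
  assume idem: "filter_product f F F = F"
  have inA: "eventually (\<lambda>x. x \<in> A) F"
    using F by (auto simp: le_principal)
  then have "eventually (\<lambda>x. x \<in> A \<and> eventually (\<lambda>y. f x y \<in> A) F) F"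
    using idem eventually_filter_product[of "\<lambda>x. x \<in> A" f F F] by (simp add: eventually_conj)
  then obtain x where x: "x \<in> A" "eventually (\<lambda>y. f x y \<in> A) F"
    using F eventually_happens' by blast
  have "eventually (\<lambda>y. y \<noteq> x) F"
    using F by (intro filter_leD[of F cofinite]) (auto simp: eventually_cofinite)
  with x(2) inA have "eventually (\<lambda>y. False) F"
    by eventually_elim (use antichain_product_notin[OF assms(1,2) x(1)] in blast)
  with F show False by (simp add: trivial_limit_def)
qed

theorem corollary1p5:
  fixes f :: "'a \<Rightarrow> 'a \<Rightarrow> 'a"
  assumes "semilattice f"
  shows "band (beta_mult f) \<longleftrightarrow> (\<forall>A. antichain f A \<longrightarrow> finite A)"
proof -
  interpret semilattice f by fact
  have band_iff: "band (beta_mult f) \<longleftrightarrow> (\<forall>F. is_ultrafilter F \<longrightarrow> filter_product f F F = F)"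
    by (rule band_beta_mult_iff) (rule semigroup_axioms)
  show ?thesis
  proof (intro iffI allI impI)
    fix A assume band: "band (beta_mult f)" and A: "antichain f A"
    show "finite A"
    proof (rule ccontr)
      assume "infinite A"
      then have "inf cofinite (principal A) \<noteq> bot"
        by (simp add: trivial_limit_def eventually_inf_principal eventually_cofinite)
      then obtain F where F: "is_ultrafilter F" "F \<le> inf cofinite (principal A)"
        by (rule ultrafilter_below_exists)
      then have "filter_product f F F \<noteq> F"
        by (intro not_idempotent_on_antichain[OF assms A]) (simp_all add: is_ultrafilter_def)
      with band F show False
        by (simp add: band_iff)
    qed
  next
    assume "\<forall>A. antichain f A \<longrightarrow> finite A"
    then show "band (beta_mult f)"
      unfolding band_iff using infinite_antichain_if_not_idempotent[OF assms] by blast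
  qed
qed

end
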